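(* There are undirected networks over time $N=(G,u,b,\tau)$ for which an earliest arrival flow exists, but which do not admit an earliest arrival contraflow. This also holds for approximations: there are such networks which admit no $\alpha$-time-approximate earliest arrival contraflow for any $\alpha<T/2$ and no $\beta$-value-approximate earliest arrival contraflow for any $\beta<U$, where $T$ and $U$ denote the largest transit time and the largest capacity in the network.
   Context: An undirected network over time $N=(G,u,b,\tau)$ consists of a finite undirected graph with capacities $u_e\ge0$, transit times $\tau_e\ge0$ and balances (supplies of sources, demands of sinks; supplies/demands may be unbounded). A flow over time assigns Lebesgue-integrable inflow rates to edges, bounded by capacities, with flow entering an edge at $\theta$ leaving at $\theta+\tau_e$, satisfying flow conservation; in an undirected network an edge may be used in both directions with the inflow rates in both directions together bounded by its capacity. $|f|_\theta$ denotes the amount of flow that has reached the sinks by time $\theta$. An orientation of $N$ replaces each edge $\{v,w\}$ by exactly one of $(v,w),(w,v)$ with the same capacity and transit time. The earliest arrival pattern is $p(\theta):=$ the maximum value of a flow over time with time horizon $\theta$ in the undirected network $N$. An earliest arrival flow in $N$ is a flow over time $f$ in $N$ with $|f|_\theta=p(\theta)$ for all $\theta$. An earliest arrival contraflow is an orientation $\overrightarrow{N}$ of $N$ together with a flow over time $f$ in $\overrightarrow{N}$ with $|f|_\theta=p(\theta)$ for all $\theta$; it is $\alpha$-time-approximate if $|f|_\theta\ge p(\theta/\alpha)$ for all $\theta$, and $\beta$-value-approximate if $|f|_\theta\ge p(\theta)/\beta$ for all $\theta$ (here $p$ is always the pattern of the undirected network). *)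

theory Defs
  imports "HOL-Analysis.Analysis"
begin

text \<open>
  Undirected networks over time \<open>N = (G, u, b, \<tau>)\<close> on a finite simple graph. A vertex with
  \<open>balance > 0\<close> is a source with that supply, a vertex with \<open>balance < 0\<close> is a sink with demand
  \<open>- balance\<close>; the values \<open>\<infinity>\<close> and \<open>-\<infinity>\<close> stand for unbounded supplies and demands.
\<close>

record 'v network =
  verts :: "'v set"
  edges :: "'v set set"
  capacity :: "'v set \<Rightarrow> real"
  balance :: "'v \<Rightarrow> ereal"
  transit :: "'v set \<Rightarrow> real"

definition is_network :: "'v network \<Rightarrow> bool" where
  "is_network N \<longleftrightarrow>
     finite (verts N) \<and>
     (\<forall>e\<in>edges N. e \<subseteq> verts N \<and> card e = 2) \<and>
     (\<forall>e\<in>edges N. 0 \<le> capacity N e \<and> 0 \<le> transit N e)"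

definition sources :: "'v network \<Rightarrow> 'v set" where
  "sources N = {v \<in> verts N. balance N v > 0}"

definition sinks :: "'v network \<Rightarrow> 'v set" where
  "sinks N = {v \<in> verts N. balance N v < 0}"

definition largest_transit :: "'v network \<Rightarrow> real" where
  "largest_transit N = Max (transit N ` edges N)"

definition largest_capacity :: "'v network \<Rightarrow> real" where
  "largest_capacity N = Max (capacity N ` edges N)"

text \<open>The arc \<open>(v, w)\<close> is the edge \<open>{v, w}\<close> traversed from \<open>v\<close> to \<open>w\<close>.\<close>

abbreviation arc_edge :: "'v \<times> 'v \<Rightarrow> 'v set" where
  "arc_edge a \<equiv> {fst a, snd a}"

definition both_arcs :: "'v network \<Rightarrow> ('v \<times> 'v) set" where
  "both_arcs N = {a. arc_edge a \<in> edges N}"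

definition orientation :: "'v network \<Rightarrow> ('v \<times> 'v) set \<Rightarrow> bool" where
  "orientation N D \<longleftrightarrow>
     D \<subseteq> both_arcs N \<and> (\<forall>v w. {v, w} \<in> edges N \<longrightarrow> ((v, w) \<in> D) \<noteq> ((w, v) \<in> D))"

text \<open>
  \<open>f a \<theta>\<close> is the rate at which flow enters the arc \<open>a\<close> at time \<open>\<theta> \<ge> 0\<close>; values at negative times
  are ignored. \<open>A\<close> is the set of arcs that may be used. The excess of \<open>v\<close> is the net amount of
  flow that has entered \<open>v\<close> by time \<open>\<theta>\<close>; the integral over \<open>{0..\<theta> - \<tau>}\<close> is \<open>0\<close> if \<open>\<theta> < \<tau>\<close>.
\<close>

type_synonym 'v rates = "'v \<times> 'v \<Rightarrow> real \<Rightarrow> real"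

definition excess :: "'v network \<Rightarrow> ('v \<times> 'v) set \<Rightarrow> 'v rates \<Rightarrow> 'v \<Rightarrow> real \<Rightarrow> real" where
  "excess N A f v \<theta> =
     (\<Sum>a\<in>{a\<in>A. snd a = v}. LINT \<xi>:{0..\<theta> - transit N (arc_edge a)}|lebesgue. f a \<xi>)
   - (\<Sum>a\<in>{a\<in>A. fst a = v}. LINT \<xi>:{0..\<theta>}|lebesgue. f a \<xi>)"

text \<open>
  Integrability is required on bounded time intervals only, because with unbounded supplies a flow
  need not end.
\<close>

definition inflow_rates :: "('v \<times> 'v) set \<Rightarrow> 'v rates \<Rightarrow> bool" where
  "inflow_rates A f \<longleftrightarrow>
     (\<forall>a\<in>A. \<forall>\<theta>\<ge>0. set_integrable lebesgue {0..\<theta>} (f a) \<and> 0 \<le> f a \<theta>)"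

definition flow_conservation :: "'v network \<Rightarrow> ('v \<times> 'v) set \<Rightarrow> 'v rates \<Rightarrow> bool" where
  "flow_conservation N A f \<longleftrightarrow>
     (\<forall>\<theta>\<ge>0.
        (\<forall>v\<in>verts N - sources N - sinks N. excess N A f v \<theta> = 0) \<and>
        (\<forall>v\<in>sources N. excess N A f v \<theta> \<le> 0 \<and> ereal (- excess N A f v \<theta>) \<le> balance N v) \<and>
        (\<forall>v\<in>sinks N. 0 \<le> excess N A f v \<theta> \<and> ereal (excess N A f v \<theta>) \<le> - balance N v))"

definition undirected_flow :: "'v network \<Rightarrow> 'v rates \<Rightarrow> bool" where
  "undirected_flow N f \<longleftrightarrow>
     inflow_rates (both_arcs N) f \<and>
     (\<forall>v w. {v, w} \<in> edges N \<longrightarrow> (\<forall>\<theta>\<ge>0. f (v, w) \<theta> + f (w, v) \<theta> \<le> capacity N {v, w})) \<and>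
     flow_conservation N (both_arcs N) f"

definition directed_flow :: "'v network \<Rightarrow> ('v \<times> 'v) set \<Rightarrow> 'v rates \<Rightarrow> bool" where
  "directed_flow N D f \<longleftrightarrow>
     inflow_rates D f \<and>
     (\<forall>a\<in>D. \<forall>\<theta>\<ge>0. f a \<theta> \<le> capacity N (arc_edge a)) \<and>
     flow_conservation N D f"

definition flow_value :: "'v network \<Rightarrow> ('v \<times> 'v) set \<Rightarrow> 'v rates \<Rightarrow> real \<Rightarrow> real" where
  "flow_value N A f \<theta> = (\<Sum>v\<in>sinks N. excess N A f v \<theta>)"

text \<open>With time horizon \<open>H\<close>, no flow remains on the arcs from time \<open>H\<close> on.\<close>

definition has_horizon :: "'v network \<Rightarrow> ('v \<times> 'v) set \<Rightarrow> 'v rates \<Rightarrow> real \<Rightarrow> bool" where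
  "has_horizon N A f H \<longleftrightarrow>
     (\<forall>a\<in>A. \<forall>\<theta>\<ge>0. \<theta> \<ge> H - transit N (arc_edge a) \<longrightarrow> f a \<theta> = 0)"

text \<open>
  The supremum is over a nonempty set (it contains the value of the zero flow) that is bounded by
  the capacities.
\<close>

definition earliest_arrival_pattern :: "'v network \<Rightarrow> real \<Rightarrow> real" where
  "earliest_arrival_pattern N \<theta> =
     Sup {flow_value N (both_arcs N) f \<theta> | f.
            undirected_flow N f \<and> has_horizon N (both_arcs N) f \<theta>}"

definition earliest_arrival_flow :: "'v network \<Rightarrow> 'v rates \<Rightarrow> bool" where
  "earliest_arrival_flow N f \<longleftrightarrow>
     undirected_flow N f \<and>
     (\<forall>\<theta>\<ge>0. flow_value N (both_arcs N) f \<theta> = earliest_arrival_pattern N \<theta>)"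

definition earliest_arrival_contraflow ::
    "'v network \<Rightarrow> ('v \<times> 'v) set \<Rightarrow> 'v rates \<Rightarrow> bool" where
  "earliest_arrival_contraflow N D f \<longleftrightarrow>
     orientation N D \<and> directed_flow N D f \<and>
     (\<forall>\<theta>\<ge>0. flow_value N D f \<theta> = earliest_arrival_pattern N \<theta>)"

definition time_approx_contraflow ::
    "real \<Rightarrow> 'v network \<Rightarrow> ('v \<times> 'v) set \<Rightarrow> 'v rates \<Rightarrow> bool" where
  "time_approx_contraflow \<alpha> N D f \<longleftrightarrow>
     orientation N D \<and> directed_flow N D f \<and>
     (\<forall>\<theta>\<ge>0. flow_value N D f \<theta> \<ge> earliest_arrival_pattern N (\<theta> / \<alpha>))"

definition value_approx_contraflow ::
    "real \<Rightarrow> 'v network \<Rightarrow> ('v \<times> 'v) set \<Rightarrow> 'v rates \<Rightarrow> bool" where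
  "value_approx_contraflow \<beta> N D f \<longleftrightarrow>
     orientation N D \<and> directed_flow N D f \<and>
     (\<forall>\<theta>\<ge>0. flow_value N D f \<theta> \<ge> earliest_arrival_pattern N \<theta> / \<beta>)"

end

theory Submission imports Defs begin

text \<open>
  On the path \<open>t\<^sub>1 - s\<^sub>1 - t\<^sub>2 - s\<^sub>2\<close>, numbered \<open>0 - 1 - 2 - 3\<close>, let all capacities be \<open>U\<close>, let the
  middle edge have transit time \<open>0\<close> and the outer edges transit time \<open>T\<close>, and let \<open>s\<^sub>1\<close> have supply
  \<open>2UT\<close>, \<open>t\<^sub>2\<close> demand \<open>UT\<close>, and \<open>s\<^sub>2\<close>, \<open>t\<^sub>1\<close> unbounded supply and demand. The pattern is
  \<open>p(\<theta>) = U\<theta>\<close>: until time \<open>T\<close> the source \<open>s\<^sub>1\<close> fills \<open>t\<^sub>2\<close> while also sending at full rate towards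
  \<open>t\<^sub>1\<close>; at time \<open>T\<close> its supply and the demand of \<open>t\<^sub>2\<close> are exhausted, and exactly then the flow of
  \<open>s\<^sub>2\<close> arrives, which crosses the middle edge in the opposite direction and keeps \<open>t\<^sub>1\<close> supplied
  forever. If the middle edge is oriented towards \<open>t\<^sub>1\<close>, nothing arrives before time \<open>T\<close>; if it is
  oriented towards \<open>t\<^sub>2\<close>, then at most \<open>3UT\<close> ever arrives. Hence no approximation factor at all is
  achievable on this network.
\<close>

section \<open>Cumulative inflow of an arc\<close>

definition cumulative :: "'v rates \<Rightarrow> 'v \<times> 'v \<Rightarrow> real \<Rightarrow> real" where
  "cumulative f a x = (LINT \<xi>:{0..x}|lebesgue. f a \<xi>)"

lemma cumulative_nonpos_time: "x \<le> 0 \<Longrightarrow> cumulative f a x = 0"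
proof -
  assume "x \<le> 0"
  then have "{0..x} = {} \<or> {0..x} = {0}" by auto
  then show ?thesis
    unfolding cumulative_def set_lebesgue_integral_def
    by (intro integral_eq_zero_AE) (auto intro: AE_I' [of "{0}"])
qed

lemma cumulative_zero: "(\<And>\<xi>. f a \<xi> = 0) \<Longrightarrow> cumulative f a x = 0"
  by (simp add: cumulative_def)

lemma set_integrable_const_Icc: "set_integrable lebesgue {x..y :: real} (\<lambda>_. c :: real)"
  unfolding set_integrable_def
  by (intro integrable_scaleR_left integrable_real_indicator) (auto simp: emeasure_lborel_Icc_eq)

lemma cumulative_bounds:
  assumes "inflow_rates A f" "a \<in> A" "\<And>\<theta>. 0 \<le> \<theta> \<Longrightarrow> f a \<theta> \<le> c"
  shows cumulative_nonneg: "0 \<le> cumulative f a x"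
    and cumulative_le: "0 \<le> x \<Longrightarrow> cumulative f a x \<le> c * x"
    and cumulative_mono: "x \<le> y \<Longrightarrow> cumulative f a x \<le> cumulative f a y"
proof -
  have int: "set_integrable lebesgue {0..x} (f a)" for x
    using assms(1,2) by (cases "0 \<le> x") (auto simp: inflow_rates_def set_integrable_def)
  have nonneg: "0 \<le> f a \<theta>" if "0 \<le> \<theta>" for \<theta>
    using assms(1,2) that by (auto simp: inflow_rates_def)
  show "0 \<le> cumulative f a x"
    unfolding cumulative_def set_lebesgue_integral_def
    by (intro integral_nonneg_AE AE_I2) (auto simp: indicator_def nonneg)
  show "cumulative f a x \<le> c * x" if "0 \<le> x"
  proof -
    have "cumulative f a x \<le> (LINT \<xi>:{0..x}|lebesgue. c)"
      unfolding cumulative_def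
      by (intro set_integral_mono int set_integrable_const_Icc) (auto simp: assms(3))
    also have "\<dots> = c * x"
      using that by (simp add: set_lebesgue_integral_def)
    finally show ?thesis .
  qed
  show "cumulative f a x \<le> cumulative f a y" if "x \<le> y"
    unfolding cumulative_def set_lebesgue_integral_def
    using int[of x] int[of y] that unfolding set_integrable_def
    by (intro integral_mono) (auto simp: indicator_def nonneg)
qed

lemma cumulative_indicator:
  assumes "\<And>\<xi>. f a \<xi> = c * indicator S \<xi>"
  shows "cumulative f a x = c * measure lebesgue (S \<inter> {0..x})"
proof -
  have "cumulative f a x = (LINT \<xi>|lebesgue. c * indicator (S \<inter> {0..x}) \<xi>)"
    unfolding cumulative_def set_lebesgue_integral_def
    by (intro Bochner_Integration.integral_cong) (auto simp: assms indicator_def)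
  then show ?thesis by simp
qed

section \<open>Flows in an orientation as undirected flows\<close>

definition restrict_rates :: "('v \<times> 'v) set \<Rightarrow> 'v rates \<Rightarrow> 'v rates" where
  "restrict_rates D f a \<xi> = (if a \<in> D then f a \<xi> else 0)"

lemma excess_restrict_rates:
  assumes "D \<subseteq> A" "finite A"
  shows "excess N A (restrict_rates D f) v \<theta> = excess N D f v \<theta>"
proof -
  have 1: "(\<Sum>a\<in>{a\<in>A. P a}. LINT \<xi>:X a|lebesgue. restrict_rates D f a \<xi>)
      = (\<Sum>a\<in>{a\<in>D. P a}. LINT \<xi>:X a|lebesgue. f a \<xi>)" for P and X :: "_ \<Rightarrow> real set"
  proof (intro sum.mono_neutral_cong_right ballI)
    fix a assume "a \<in> {a\<in>A. P a} - {a\<in>D. P a}"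
    then have "restrict_rates D f a = (\<lambda>_. 0)" by (auto simp: restrict_rates_def)
    then show "(LINT \<xi>:X a|lebesgue. restrict_rates D f a \<xi>) = 0" by simp
  qed (use assms in \<open>auto simp: restrict_rates_def\<close>)
  show ?thesis by (simp only: excess_def 1)
qed

lemma finite_both_arcs: "is_network N \<Longrightarrow> finite (both_arcs N)"
  by (rule finite_subset[of _ "verts N \<times> verts N"]) (auto simp: is_network_def both_arcs_def)

text \<open>Of the two arcs of an edge exactly one lies in \<open>D\<close>, so after extension by
  zero the joint capacity bound is the directed one. Hence every bound on undirected flows also
  applies to flows in an orientation.\<close>

lemma undirected_flow_restrict_rates:
  assumes N: "is_network N" and D: "orientation N D" and f: "directed_flow N D f"
  shows "undirected_flow N (restrict_rates D f)"
proof -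
  have sub: "D \<subseteq> both_arcs N" using D by (simp add: orientation_def)
  note ex = excess_restrict_rates[OF sub finite_both_arcs[OF N]]
  have "inflow_rates (both_arcs N) (restrict_rates D f)"
    using f unfolding directed_flow_def inflow_rates_def restrict_rates_def
    by (auto simp: set_integrable_def)
  moreover have "restrict_rates D f (v, w) \<theta> + restrict_rates D f (w, v) \<theta> \<le> capacity N {v, w}"
    if "{v, w} \<in> edges N" "0 \<le> \<theta>" for v w \<theta>
  proof -
    have "((v, w) \<in> D) \<noteq> ((w, v) \<in> D)" using D that by (auto simp: orientation_def)
    then show ?thesis using f that(2)
      by (force simp: directed_flow_def restrict_rates_def insert_commute)
  qed
  ultimately show ?thesis
    using f unfolding undirected_flow_def directed_flow_def flow_conservation_def ex by blast
qed

lemma flow_value_restrict_rates: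
  assumes "is_network N" "orientation N D"
  shows "flow_value N (both_arcs N) (restrict_rates D f) \<theta> = flow_value N D f \<theta>"
  using assms
  by (simp add: flow_value_def orientation_def excess_restrict_rates finite_both_arcs)

section \<open>The path network and its excess formulas\<close>

definition path_network :: "real \<Rightarrow> real \<Rightarrow> nat network" where
  "path_network T U =
     \<lparr>verts = {0, 1, 2, 3}, edges = {{0, 1}, {1, 2}, {2, 3}}, capacity = (\<lambda>e. U),
      balance = (\<lambda>v. if v = 0 then - \<infinity> else if v = 1 then ereal (2 * U * T)
                     else if v = 2 then ereal (- (U * T)) else \<infinity>),
      transit = (\<lambda>e. if e = {1, 2} then 0 else T)\<rparr>"

locale path_net =
  fixes T U :: real
  assumes T_pos: "0 < T" and U_pos: "0 < U"
begin

abbreviation "N \<equiv> path_network T U"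
abbreviation "arcs \<equiv> both_arcs N"

lemma is_network: "is_network N"
  using T_pos U_pos by (auto simp: is_network_def path_network_def card_insert_if)

lemma largest: "largest_transit N = T" "largest_capacity N = U"
proof -
  have "transit N ` edges N = {T, 0}"
    by (auto simp: path_network_def doubleton_eq_iff)
  then show "largest_transit N = T"
    using T_pos by (simp add: largest_transit_def)
  show "largest_capacity N = U"
    by (simp add: largest_capacity_def path_network_def)
qed

lemma arcs_eq: "arcs = {(0, 1), (1, 0), (1, 2), (2, 1), (2, 3), (3, 2)}"
proof (intro equalityI subrelI)
  fix v w assume "(v, w) \<in> arcs"
  then show "(v, w) \<in> {(0, 1), (1, 0), (1, 2), (2, 1), (2, 3), (3, 2)}"
    by (simp add: both_arcs_def path_network_def doubleton_eq_iff)
next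
  fix v w :: nat assume "(v, w) \<in> {(0, 1), (1, 0), (1, 2), (2, 1), (2, 3), (3, 2)}"
  then show "(v, w) \<in> arcs"
    by (simp add: both_arcs_def path_network_def) (elim disjE conjE; simp add: insert_commute)
qed

lemma sources: "sources N = {1, 3}" and sinks: "sinks N = {0, 2}"
  using T_pos mult_pos_pos[OF U_pos T_pos]
  by (auto simp: sources_def sinks_def path_network_def mult.commute split: if_splits)

lemma arcs_at:
  "{a \<in> arcs. snd a = 0} = {(1, 0)}" "{a \<in> arcs. fst a = 0} = {(0, 1)}"
  "{a \<in> arcs. snd a = 1} = {(0, 1), (2, 1)}" "{a \<in> arcs. fst a = 1} = {(1, 0), (1, 2)}"
  "{a \<in> arcs. snd a = 2} = {(1, 2), (3, 2)}" "{a \<in> arcs. fst a = 2} = {(2, 1), (2, 3)}"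
  "{a \<in> arcs. snd a = 3} = {(2, 3)}" "{a \<in> arcs. fst a = 3} = {(3, 2)}"
  unfolding arcs_eq by auto

lemma transit_arcs:
  "transit N {0, 1} = T" "transit N {1, 0} = T" "transit N {1, 2} = 0" "transit N {2, 1} = 0"
  "transit N {2, 3} = T" "transit N {3, 2} = T"
  by (auto simp: path_network_def doubleton_eq_iff)

lemma excess_path:
  "excess N arcs f 0 \<theta> = cumulative f (1, 0) (\<theta> - T) - cumulative f (0, 1) \<theta>"
  "excess N arcs f 1 \<theta> = cumulative f (0, 1) (\<theta> - T) + cumulative f (2, 1) \<theta>
     - cumulative f (1, 0) \<theta> - cumulative f (1, 2) \<theta>"
  "excess N arcs f 2 \<theta> = cumulative f (1, 2) \<theta> + cumulative f (3, 2) (\<theta> - T)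
     - cumulative f (2, 1) \<theta> - cumulative f (2, 3) \<theta>"
  "excess N arcs f 3 \<theta> = cumulative f (2, 3) (\<theta> - T) - cumulative f (3, 2) \<theta>"
  unfolding excess_def arcs_at by (simp_all add: transit_arcs cumulative_def del: One_nat_def)

lemma flow_value_path: "flow_value N arcs f \<theta> = excess N arcs f 0 \<theta> + excess N arcs f 2 \<theta>"
  by (simp add: flow_value_def sinks)

text \<open>Every vertex is a source or a sink, so only inequalities remain, and the infinite
  balances of 0 and 3 impose no bound on the amount.\<close>

lemma conservation_path:
  "flow_conservation N arcs f \<longleftrightarrow> (\<forall>\<theta>\<ge>0.
     - (2 * U * T) \<le> excess N arcs f 1 \<theta> \<and> excess N arcs f 1 \<theta> \<le> 0 \<and> excess N arcs f 3 \<theta> \<le> 0 \<and>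
     0 \<le> excess N arcs f 0 \<theta> \<and> 0 \<le> excess N arcs f 2 \<theta> \<and> excess N arcs f 2 \<theta> \<le> U * T)"
proof -
  have b: "balance N 0 = - \<infinity>" "balance N 1 = ereal (2 * U * T)" "balance N 2 = ereal (- (U * T))"
    "balance N 3 = \<infinity>" "verts N - sources N - sinks N = {}"
    unfolding sources sinks by (auto simp: path_network_def)
  show ?thesis
    unfolding flow_conservation_def b(5) unfolding sources sinks ball_simps b
    by (simp add: minus_le_iff[of "excess _ _ _ _ _"] conj_ac del: One_nat_def)
qed

section \<open>Upper bounds on arrivals in an arbitrary flow\<close>

context
  fixes f :: "nat rates"
  assumes flow: "undirected_flow N f"
begin

lemma rate_le: "a \<in> arcs \<Longrightarrow> 0 \<le> \<theta> \<Longrightarrow> f a \<theta> \<le> U"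
proof -
  assume a: "a \<in> arcs" "0 \<le> \<theta>"
  obtain v w where vw: "a = (v, w)" by fastforce
  have e: "{v, w} \<in> edges N" using a vw by (simp add: both_arcs_def)
  then have "(w, v) \<in> arcs" by (simp add: both_arcs_def insert_commute)
  then have "0 \<le> f (w, v) \<theta>"
    using flow a by (auto simp: undirected_flow_def inflow_rates_def)
  moreover have "f (v, w) \<theta> + f (w, v) \<theta> \<le> capacity N {v, w}"
    using flow a(2) e by (simp add: undirected_flow_def)
  ultimately show ?thesis by (simp add: vw path_network_def)
qed

lemma rates: "inflow_rates arcs f"
  using flow by (simp add: undirected_flow_def)

lemmas cumulative_flow =
  cumulative_nonneg[OF rates _ rate_le] cumulative_le[OF rates _ rate_le]
  cumulative_mono[OF rates _ rate_le]

lemma conservation: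
  assumes "0 \<le> \<theta>"
  shows "- (2 * U * T) \<le> excess N arcs f 1 \<theta>" "excess N arcs f 2 \<theta> \<le> U * T"
  using flow assms by (simp_all add: undirected_flow_def conservation_path)

text \<open>Up to time \<open>T\<close> the flow from vertex 3 is still in transit, so vertex 2 can
  only be fed across the middle edge.\<close>

lemma excess_2_early:
  assumes "0 \<le> \<theta>" "\<theta> \<le> T"
  shows "excess N arcs f 2 \<theta> \<le> cumulative f (1, 2) \<theta>"
proof -
  have "cumulative f (3, 2) (\<theta> - T) = 0" using assms by (simp add: cumulative_nonpos_time)
  moreover have "0 \<le> cumulative f (2, 1) \<theta>" "0 \<le> cumulative f (2, 3) \<theta>"
    by (auto intro!: cumulative_flow simp: arcs_eq)
  ultimately show ?thesis unfolding excess_path by simp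
qed

lemma excess_0_le: "excess N arcs f 0 \<theta> \<le> cumulative f (1, 0) (\<theta> - T)"
proof -
  have "0 \<le> cumulative f (0, 1) \<theta>" by (auto intro!: cumulative_flow simp: arcs_eq)
  then show ?thesis unfolding excess_path by simp
qed

text \<open>Up to time \<open>T\<close> nothing has reached vertex 0, and vertex 2 is fed through
  one arc of capacity \<open>U\<close>. Later, vertex 2 holds at most its demand
  \<open>U * T\<close> and vertex 0 has received at most \<open>U * (\<theta> - T)\<close>.\<close>

lemma flow_value_le:
  assumes "0 \<le> \<theta>"
  shows "flow_value N arcs f \<theta> \<le> U * \<theta>"
proof (cases "\<theta> \<le> T")
  case True
  have "cumulative f (1, 2) \<theta> \<le> U * \<theta>"
    using assms by (auto intro!: cumulative_flow simp: arcs_eq)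
  then show ?thesis
    using excess_0_le[of \<theta>] excess_2_early[OF assms True] True
    by (simp add: flow_value_path cumulative_nonpos_time)
next
  case False
  then have "cumulative f (1, 0) (\<theta> - T) \<le> U * (\<theta> - T)"
    by (auto intro!: cumulative_flow simp: arcs_eq)
  then show ?thesis
    using excess_0_le[of \<theta>] conservation(2)[OF assms]
    by (simp add: flow_value_path algebra_simps)
qed

lemma flow_value_early:
  assumes "\<And>\<xi>. f (1, 2) \<xi> = 0" "0 \<le> \<theta>" "\<theta> \<le> T"
  shows "flow_value N arcs f \<theta> \<le> 0"
  using excess_0_le[of \<theta>] excess_2_early[OF assms(2,3)] assms
  by (simp add: flow_value_path cumulative_nonpos_time cumulative_zero)

text \<open>Without the arc \<open>(2, 1)\<close>, vertex 0 lives on the supply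
  \<open>2 * U * T\<close> of vertex 1 alone; the demand of vertex 2 adds at most
  \<open>U * T\<close>.\<close>

lemma flow_value_bounded:
  assumes "\<And>\<xi>. f (2, 1) \<xi> = 0" "0 \<le> \<theta>"
  shows "flow_value N arcs f \<theta> \<le> 3 * U * T"
proof -
  have "cumulative f (1, 0) (\<theta> - T) \<le> cumulative f (1, 0) \<theta>"
    "cumulative f (0, 1) (\<theta> - T) \<le> cumulative f (0, 1) \<theta>" "0 \<le> cumulative f (1, 2) \<theta>"
    using T_pos by (auto intro!: cumulative_flow simp: arcs_eq)
  then have "excess N arcs f 0 \<theta> \<le> - excess N arcs f 1 \<theta>"
    unfolding excess_path using assms(1) by (simp add: cumulative_zero)
  then show ?thesis
    using conservation[OF assms(2)] by (simp add: flow_value_path)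
qed

end

section \<open>The greedy flow\<close>

text \<open>
  Flow leaves \<open>s\<^sub>2\<close> only if it can reach \<open>t\<^sub>1\<close> by time \<open>H\<close>, i.e. at times before \<open>H - 2T\<close>; the
  horizon \<open>\<infinity>\<close> gives the earliest arrival flow.
\<close>

definition greedy_window :: "ereal \<Rightarrow> nat \<times> nat \<Rightarrow> real set" where
  "greedy_window H a =
     (if a = (1, 2) then {\<xi>. 0 \<le> \<xi> \<and> ereal \<xi> < min H T}
      else if a = (1, 0) then {\<xi>. 0 \<le> \<xi> \<and> ereal \<xi> < H - T}
      else if a = (2, 1) then {\<xi>. T \<le> \<xi> \<and> ereal \<xi> < H - T}
      else if a = (3, 2) then {\<xi>. 0 \<le> \<xi> \<and> ereal \<xi> < H - 2 * T}
      else {})"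

lemma greedy_window_at:
  "greedy_window H (1, 2) = {\<xi>. 0 \<le> \<xi> \<and> ereal \<xi> < min H T}"
  "greedy_window H (1, 0) = {\<xi>. 0 \<le> \<xi> \<and> ereal \<xi> < H - T}"
  "greedy_window H (2, 1) = {\<xi>. T \<le> \<xi> \<and> ereal \<xi> < H - T}"
  "greedy_window H (3, 2) = {\<xi>. 0 \<le> \<xi> \<and> ereal \<xi> < H - 2 * T}"
  "greedy_window H (0, 1) = {}" "greedy_window H (2, 3) = {}"
  by (simp_all add: greedy_window_def)

definition greedy :: "ereal \<Rightarrow> nat rates" where
  "greedy H a \<xi> = U * indicator (greedy_window H a) \<xi>"

lemma cumulative_greedy:
  "cumulative (greedy H) a x = U * measure lebesgue (greedy_window H a \<inter> {0..x})"
  by (rule cumulative_indicator) (simp add: greedy_def)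

text \<open>The set is an interval from \<open>l\<close> to the smaller of \<open>r\<close> and
  \<open>x\<close>, and \<open>max 0\<close> covers the empty case. The minimum is finite even for
  \<open>r = \<infinity>\<close>, so \<open>real_of_ereal\<close> never falls back on its default
  value.\<close>

lemma measure_window:
  assumes "0 \<le> l" "r \<noteq> - \<infinity>"
  shows "measure lebesgue ({\<xi>. l \<le> \<xi> \<and> ereal \<xi> < r} \<inter> {0..x}) = max 0 (real_of_ereal (min r x) - l)"
proof (cases "ereal x < r")
  case True
  then have "{\<xi>. l \<le> \<xi> \<and> ereal \<xi> < r} \<inter> {0..x} = {l..x}"
    using assms(1) by (auto intro: le_less_trans[of _ "ereal x"])
  then show ?thesis using True by (cases "l \<le> x") (auto simp: min_def)
next
  case False
  then obtain r' where r': "r = ereal r'" using assms(2) by (cases r) auto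
  then have "{\<xi>. l \<le> \<xi> \<and> ereal \<xi> < r} \<inter> {0..x} = {l..<r'}"
    using assms(1) False by auto
  then show ?thesis using False r' by (cases "l \<le> r'") (simp_all add: min_def)
qed

lemma cumulative_greedy_window:
  assumes "H \<noteq> - \<infinity>"
  shows "cumulative (greedy H) (1, 2) x = U * max 0 (real_of_ereal (min (min H T) x))"
    "cumulative (greedy H) (1, 0) x = U * max 0 (real_of_ereal (min (H - T) x))"
    "cumulative (greedy H) (2, 1) x = U * max 0 (real_of_ereal (min (H - T) x) - T)"
    "cumulative (greedy H) (3, 2) x = U * max 0 (real_of_ereal (min (H - 2 * T) x))"
    "cumulative (greedy H) (0, 1) x = 0" "cumulative (greedy H) (2, 3) x = 0"
proof -
  have "min H T \<noteq> - \<infinity>" "H - T \<noteq> - \<infinity>" "H - 2 * T \<noteq> - \<infinity>"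
    using assms by (cases H; simp add: min_def)+
  note m = measure_window[OF _ this(1)] measure_window[OF _ this(2)] measure_window[OF _ this(3)]
  show "cumulative (greedy H) (1, 2) x = U * max 0 (real_of_ereal (min (min H T) x))"
    "cumulative (greedy H) (1, 0) x = U * max 0 (real_of_ereal (min (H - T) x))"
    "cumulative (greedy H) (2, 1) x = U * max 0 (real_of_ereal (min (H - T) x) - T)"
    "cumulative (greedy H) (3, 2) x = U * max 0 (real_of_ereal (min (H - 2 * T) x))"
    "cumulative (greedy H) (0, 1) x = 0" "cumulative (greedy H) (2, 3) x = 0"
    unfolding cumulative_greedy greedy_window_at
    by (simp_all only: m order.refl less_imp_le[OF T_pos] diff_0_right Int_empty_left
        measure_empty mult_zero_right)
qed

lemma excess_greedy:
  fixes \<theta> :: real and H :: ereal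
  assumes "H \<noteq> - \<infinity>"
  defines "m \<equiv> real_of_ereal (min (H - T) \<theta>)"
  shows "excess N arcs (greedy H) 0 \<theta> = U * max 0 (real_of_ereal (min (H - T) (\<theta> - T)))"
    "excess N arcs (greedy H) 1 \<theta>
      = U * (max 0 (m - T) - max 0 m - max 0 (real_of_ereal (min (min H T) \<theta>)))"
    "excess N arcs (greedy H) 2 \<theta> = U * max 0 (real_of_ereal (min (min H T) \<theta>))"
    "excess N arcs (greedy H) 3 \<theta> = - U * max 0 (real_of_ereal (min (H - 2 * T) \<theta>))"
proof -
  \<comment> \<open>The window of \<open>(3, 2)\<close>, delayed by \<open>T\<close>, is that of
    \<open>(2, 1)\<close>: vertex 2 passes on all that arrives from vertex 3, and the two terms
    cancel in its excess.\<close>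
  have *: "real_of_ereal (min (H - 2 * T) (\<theta> - T)) = m - T"
    using assms(1) unfolding m_def by (cases H) (auto simp: min_def)
  show
    "excess N arcs (greedy H) 0 \<theta> = U * max 0 (real_of_ereal (min (H - T) (\<theta> - T)))"
    "excess N arcs (greedy H) 1 \<theta>
      = U * (max 0 (m - T) - max 0 m - max 0 (real_of_ereal (min (min H T) \<theta>)))"
    "excess N arcs (greedy H) 2 \<theta> = U * max 0 (real_of_ereal (min (min H T) \<theta>))"
    "excess N arcs (greedy H) 3 \<theta> = - U * max 0 (real_of_ereal (min (H - 2 * T) \<theta>))"
    unfolding excess_path cumulative_greedy_window[OF assms(1)] * by (simp_all add: m_def right_diff_distrib)
qed

lemma undirected_flow_greedy:
  assumes "H \<noteq> - \<infinity>"
  shows "undirected_flow N (greedy H)"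
proof -
  have "set_integrable lebesgue {0..\<theta>} (greedy H a)" for a \<theta>
  proof -
    have "greedy_window H a \<in> sets lebesgue"
      unfolding greedy_window_def by auto
    then have "set_integrable lebesgue ({0..\<theta>} \<inter> greedy_window H a) (\<lambda>_. U)"
      by (intro set_integrable_subset[OF set_integrable_const_Icc[of 0 \<theta>]]) auto
    moreover have "(\<lambda>\<xi>. indicator ({0..\<theta>} \<inter> greedy_window H a) \<xi> *\<^sub>R U)
        = (\<lambda>\<xi>. indicator {0..\<theta>} \<xi> *\<^sub>R greedy H a \<xi>)"
      by (auto simp: greedy_def indicator_def)
    ultimately show ?thesis by (simp only: set_integrable_def)
  qed
  then have "inflow_rates arcs (greedy H)"
    using U_pos by (auto simp: inflow_rates_def greedy_def)
  moreover have "greedy H (v, w) \<theta> + greedy H (w, v) \<theta> \<le> capacity N {v, w}"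
    if "{v, w} \<in> edges N" "0 \<le> \<theta>" for v w \<theta>
  proof -
    \<comment> \<open>Only the middle edge can have nonempty windows in both directions; they are
      separated at \<open>T\<close>, with \<open>T\<close> itself belonging to \<open>(2, 1)\<close>
      only.\<close>
    have "greedy_window H (v, w) \<inter> greedy_window H (w, v) = {}"
      by (auto simp: greedy_window_def split: if_splits)
    then show ?thesis
      using U_pos by (auto simp: greedy_def path_network_def indicator_def)
  qed
  moreover have "flow_conservation N arcs (greedy H)"
  proof -
    \<comment> \<open>In units of \<open>U\<close>, \<open>k\<close> is what vertex 2 gets from
      vertex 1, and \<open>max 0 m - max 0 (m - T)\<close> is what vertex 1 sends to vertex 0 beyond
      its relief from vertex 3. Each is at most \<open>T\<close>, which explains the supply
      \<open>2 * U * T\<close>.\<close>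
    have 1: "- (2 * T) \<le> max 0 (m - T) - max 0 m - max 0 k"
      "max 0 (m - T) - max 0 m - max 0 k \<le> 0" "max 0 k \<le> T" if "k \<le> T" for k m :: real
      using that T_pos by (auto simp: max_def)
    have "real_of_ereal (min (min H T) \<theta>) \<le> T" for \<theta> :: real
      using assms T_pos by (cases H) (auto simp: min_def)
    note bounds = 1[OF this, THEN mult_left_mono, OF less_imp_le[OF U_pos]]
    have "- (2 * U * T) = U * - (2 * T)" by simp
    then show ?thesis
      unfolding conservation_path excess_greedy[OF assms]
      by (intro allI impI conjI) (simp_all only: bounds bounds(2)[unfolded mult_zero_right],
          use U_pos in simp_all)
  qed
  ultimately show ?thesis by (auto simp: undirected_flow_def)
qed

text \<open>Vertex 2 receives at rate \<open>U\<close> until time \<open>T\<close> and vertex 0 does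
  so from then on.\<close>

lemma flow_value_greedy:
  assumes "0 \<le> \<theta>" "ereal \<theta> \<le> H"
  shows "flow_value N arcs (greedy H) \<theta> = U * \<theta>"
proof -
  have H: "H \<noteq> - \<infinity>" using assms by auto
  have "max 0 (real_of_ereal (min (H - T) (\<theta> - T))) + max 0 (real_of_ereal (min (min H T) \<theta>)) = \<theta>"
    using assms T_pos by (cases H) (auto simp: min_def max_def)
  then show ?thesis
    unfolding flow_value_path excess_greedy[OF H] by (metis distrib_left)
qed

text \<open>The right ends of the windows are excluded because the rate must already vanish at time
  \<open>H - transit\<close>.\<close>

lemma has_horizon_greedy: "has_horizon N arcs (greedy (ereal H)) H"
  unfolding has_horizon_def arcs_eq ball_simps using T_pos
  by (simp add: greedy_def greedy_window_at transit_arcs del: One_nat_def)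

section \<open>The pattern and the failure of every orientation\<close>

text \<open>The flow \<open>greedy \<infinity>\<close> never empties the arcs, so the maximum is
  attained by the truncated flow with horizon \<open>\<theta>\<close>, which has the same value at
  that time.\<close>

lemma pattern_path:
  assumes "0 \<le> \<theta>"
  shows "earliest_arrival_pattern N \<theta> = U * \<theta>"
  unfolding earliest_arrival_pattern_def
proof (rule cSup_eq_maximum)
  show "U * \<theta> \<in> {flow_value N arcs f \<theta> |f. undirected_flow N f \<and> has_horizon N arcs f \<theta>}"
    using has_horizon_greedy undirected_flow_greedy flow_value_greedy[OF assms, of "ereal \<theta>"]
    by (smt (verit) MInfty_neq_ereal(1) mem_Collect_eq order.refl)
qed (use flow_value_le assms in auto)

lemma earliest_arrival_flow_greedy: "earliest_arrival_flow N (greedy \<infinity>)"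
  by (simp add: earliest_arrival_flow_def undirected_flow_greedy flow_value_greedy pattern_path)

text \<open>The orientation drops one of the two middle arcs, and the extension by zero then meets
  the hypothesis of one of the two bounds. The time \<open>T / 2\<close> stands for any time in
  \<open>(0, T]\<close>.\<close>

lemma orientation_dichotomy:
  assumes D: "orientation N D" and f: "directed_flow N D f"
  shows "flow_value N D f (T / 2) \<le> 0 \<or> (\<forall>\<theta>\<ge>0. flow_value N D f \<theta> \<le> 3 * U * T)"
proof -
  let ?g = "restrict_rates D f"
  have g: "undirected_flow N ?g"
    by (rule undirected_flow_restrict_rates[OF is_network D f])
  have "{1, 2} \<in> edges N" by (simp add: path_network_def)
  then consider "(1, 2) \<notin> D" | "(2, 1) \<notin> D"
    using D by (auto simp: orientation_def)
  then show ?thesis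
  proof cases
    case 1
    then show ?thesis
      using flow_value_early[OF g, of "T / 2"] T_pos
      by (simp add: restrict_rates_def flow_value_restrict_rates[OF is_network D])
  next
    case 2
    then show ?thesis
      using flow_value_bounded[OF g]
      by (simp add: restrict_rates_def flow_value_restrict_rates[OF is_network D])
  qed
qed

lemma no_time_approx: "0 < \<alpha> \<Longrightarrow> \<not> time_approx_contraflow \<alpha> N D f"
proof
  assume \<alpha>: "0 < \<alpha>" and "time_approx_contraflow \<alpha> N D f"
  then have D: "orientation N D" "directed_flow N D f"
    and val: "\<And>\<theta>. 0 \<le> \<theta> \<Longrightarrow> U * (\<theta> / \<alpha>) \<le> flow_value N D f \<theta>"
    by (auto simp: time_approx_contraflow_def pattern_path)
  \<comment> \<open>Two test times: at \<open>T / 2\<close> a positive value is required, and at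
    \<open>4 * T * \<alpha>\<close> the value \<open>4 * U * T\<close>, which exceeds
    \<open>3 * U * T\<close>.\<close>
  have "0 < U * (T / 2 / \<alpha>)" "3 * U * T < U * (4 * T * \<alpha> / \<alpha>)" "0 \<le> 4 * T * \<alpha>"
    using \<alpha> T_pos U_pos by auto
  then show False
    using orientation_dichotomy[OF D] val[of "T / 2"] val[of "4 * T * \<alpha>"] T_pos
    by (auto dest: spec[of _ "4 * T * \<alpha>"] simp del: nonzero_mult_div_cancel_right)
qed

text \<open>The pattern is linear, so dividing the value by \<open>\<beta>\<close> is the same as
  dividing the time by \<open>\<beta>\<close>.\<close>

lemma no_value_approx: "0 < \<beta> \<Longrightarrow> \<not> value_approx_contraflow \<beta> N D f"
proof
  assume \<beta>: "0 < \<beta>" and "value_approx_contraflow \<beta> N D f"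
  then have "time_approx_contraflow \<beta> N D f"
    by (simp add: value_approx_contraflow_def time_approx_contraflow_def pattern_path)
  then show False using no_time_approx[OF \<beta>] by simp
qed

lemma no_contraflow: "\<not> earliest_arrival_contraflow N D f"
  using no_time_approx[of 1 D f]
  by (auto simp: earliest_arrival_contraflow_def time_approx_contraflow_def)

end

theorem theorem6:
  shows "(\<exists>N :: nat network.
            is_network N \<and>
            (\<exists>f. earliest_arrival_flow N f) \<and>
            \<not> (\<exists>D f. earliest_arrival_contraflow N D f))
       \<and> (\<forall>T U :: real. 0 < T \<and> 0 < U \<longrightarrow>
            (\<exists>N :: nat network.
               is_network N \<and> largest_transit N = T \<and> largest_capacity N = U \<and>
               (\<exists>f. earliest_arrival_flow N f) \<and>
               \<not> (\<exists>D f. earliest_arrival_contraflow N D f) \<and>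
               (\<forall>\<alpha>. 0 < \<alpha> \<and> \<alpha> < T / 2 \<longrightarrow> \<not> (\<exists>D f. time_approx_contraflow \<alpha> N D f)) \<and>
               (\<forall>\<beta>. 0 < \<beta> \<and> \<beta> < U \<longrightarrow> \<not> (\<exists>D f. value_approx_contraflow \<beta> N D f))))"
proof (intro conjI allI impI)
  interpret path_net 1 1 by unfold_locales simp_all
  show "\<exists>N :: nat network. is_network N \<and> (\<exists>f. earliest_arrival_flow N f) \<and>
      \<not> (\<exists>D f. earliest_arrival_contraflow N D f)"
    using is_network earliest_arrival_flow_greedy no_contraflow by blast
next
  fix T U :: real
  assume "0 < T \<and> 0 < U"
  then interpret path_net T U by unfold_locales simp_all
  show "\<exists>N :: nat network.
      is_network N \<and> largest_transit N = T \<and> largest_capacity N = U \<and>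
      (\<exists>f. earliest_arrival_flow N f) \<and>
      \<not> (\<exists>D f. earliest_arrival_contraflow N D f) \<and>
      (\<forall>\<alpha>. 0 < \<alpha> \<and> \<alpha> < T / 2 \<longrightarrow> \<not> (\<exists>D f. time_approx_contraflow \<alpha> N D f)) \<and>
      (\<forall>\<beta>. 0 < \<beta> \<and> \<beta> < U \<longrightarrow> \<not> (\<exists>D f. value_approx_contraflow \<beta> N D f))"
    using is_network largest earliest_arrival_flow_greedy no_contraflow no_time_approx
      no_value_approx by blast
qed

end
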